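(* Let $H\in\mathbb{C}^{n\times n}$ be an invertible Hermitian matrix and let $B\in\mathbb{C}^{n\times n}$ be an $H$-nonnegative matrix with no negative eigenvalues and no Jordan blocks of size two at the eigenvalue zero, such that $(B,H)$ is in canonical form. Let $\mathcal{S}$ be a Segre pairing of $B$, with $\ell_1$ pairs $(1,0)$ and $\ell_2$ pairs $(1,1)$, according to which (after a permutation of blocks) $$B=\bigoplus_{i=1}^{\ell_1}J_1(0)\oplus\bigoplus_{i=1}^{\ell_2}\bigl(J_1(0)\oplus J_1(0)\bigr)\oplus\bigoplus_{i=1}^qJ_1(\lambda_i),$$ $$H=\bigoplus_{i=1}^{\ell_1}\delta_iQ_1\oplus\bigoplus_{i=1}^{\ell_2}\bigl(Q_1\oplus -Q_1\bigr)\oplus\bigoplus_{i=1}^qQ_1,$$ where $\lambda_i>0$ and $\delta_i=\pm1$. Then there exists an unconditionally stable $H$-nonnegative square root of $B$ if and only if $$\ell_2=0\quad\text{and}\quad \delta_i=1\ \text{ for all } i=1,\ldots,\ell_1.$$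
   Context: With $(\cdot,\cdot)$ the Euclidean inner product on $\mathbb{C}^n$ and $[x,y]=(Hx,y)$, a matrix $B\in\mathbb{C}^{n\times n}$ is $H$-nonnegative if $[Bx,x]\ge 0$ for all $x\in\mathbb{C}^n$. An $H$-nonnegative square root of $B$ is an $H$-nonnegative matrix $A$ with $A^2=B$. $J_1(\lambda)=[\lambda]$ and $Q_1=[1]$. The pair $(B,H)$, with $B$ as in the claim, is in canonical form if $B=\bigoplus_{i=1}^qJ_1(\lambda_i)\oplus\bigoplus_{i=1}^sJ_1(0)$ and $H=\bigoplus_{i=1}^qQ_1\oplus\bigoplus_{i=1}^s\varepsilon_iQ_1$ with $\lambda_i>0$, $\varepsilon_i=\pm1$. A Segre pairing of such a $B$ is a collection of pairs $(1,1)$ and $(1,0)$ (repetitions allowed) such that each of the $s$ zero Jordan blocks (of size one) is used in exactly one pair; here the two blocks in each pair $(1,1)$ have opposite signs $\varepsilon$. An $H$-nonnegative square root $A$ of an $H$-nonnegative matrix $B$ is called unconditionally stable if for all $\varepsilon>0$ there exists $\delta>0$ such that every $H$-nonnegative matrix $\tilde B$ with $\|B-\tilde B\|<\delta$ has an $H$-nonnegative square root $\tilde A$ with $\|A-\tilde A\|<\varepsilon$. *)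

theory Defs
  imports
    Complex_Main
    "Jordan_Normal_Form.Jordan_Normal_Form"
    "Jordan_Normal_Form.Schur_Decomposition"
begin

text \<open>\<open>v \<bullet>c w\<close> is the Euclidean inner product, linear in \<open>v\<close> and conjugate linear in \<open>w\<close>.\<close>

definition ip_H :: "complex mat \<Rightarrow> complex vec \<Rightarrow> complex vec \<Rightarrow> complex" where
  "ip_H H x y = (H *\<^sub>v x) \<bullet>c y"

text \<open>In the order on the complex numbers, \<open>0 \<le> z\<close> says that \<open>z\<close> is real and nonnegative.\<close>

definition H_nonneg :: "nat \<Rightarrow> complex mat \<Rightarrow> complex mat \<Rightarrow> bool" where
  "H_nonneg n H B \<longleftrightarrow>
     B \<in> carrier_mat n n \<and> (\<forall>x \<in> carrier_vec n. 0 \<le> ip_H H (B *\<^sub>v x) x)"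

definition H_nonneg_sqrt :: "nat \<Rightarrow> complex mat \<Rightarrow> complex mat \<Rightarrow> complex mat \<Rightarrow> bool" where
  "H_nonneg_sqrt n H B A \<longleftrightarrow> H_nonneg n H A \<and> A * A = B"

text \<open>The Frobenius norm. All norms on the \<open>n \<times> n\<close> matrices are equivalent, so the
  notion of stability below does not depend on this choice.\<close>

definition mat_norm :: "complex mat \<Rightarrow> real" where
  "mat_norm M = sqrt (\<Sum>i<dim_row M. \<Sum>j<dim_col M. (cmod (M $$ (i, j)))\<^sup>2)"

definition unconditionally_stable ::
  "nat \<Rightarrow> complex mat \<Rightarrow> complex mat \<Rightarrow> complex mat \<Rightarrow> bool" where
  "unconditionally_stable n H B A \<longleftrightarrow>
     H_nonneg_sqrt n H B A \<and>
     (\<forall>\<epsilon>>0. \<exists>\<delta>>0. \<forall>B'. H_nonneg n H B' \<and> mat_norm (B - B') < \<delta> \<longrightarrow>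
        (\<exists>A'. H_nonneg_sqrt n H B' A' \<and> mat_norm (A - A') < \<epsilon>))"

abbreviation Q1 :: "complex mat" where
  "Q1 \<equiv> 1\<^sub>m 1"

definition canonical_form ::
  "complex mat \<Rightarrow> complex mat \<Rightarrow> real list \<Rightarrow> complex list \<Rightarrow> bool" where
  "canonical_form B H lams eps \<longleftrightarrow>
     (\<forall>l \<in> set lams. 0 < l) \<and> set eps \<subseteq> {1, -1} \<and>
     B = diag_block_mat (map (\<lambda>l. jordan_block 1 (complex_of_real l)) lams
                         @ replicate (length eps) (jordan_block 1 0)) \<and>
     H = diag_block_mat (replicate (length lams) Q1 @ map (\<lambda>e. e \<cdot>\<^sub>m Q1) eps)"

text \<open>The zero Jordan blocks are numbered \<open>0, \<dots>, length eps - 1\<close>. \<open>singles\<close> lists the blocks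
  used in the pairs \<open>(1,0)\<close>, and \<open>couples\<close> the two blocks used in each pair \<open>(1,1)\<close>. Each
  couple is written with its block of sign \<open>+1\<close> first.\<close>

definition segre_pairing :: "complex list \<Rightarrow> nat list \<Rightarrow> (nat \<times> nat) list \<Rightarrow> bool" where
  "segre_pairing eps singles couples \<longleftrightarrow>
     distinct (singles @ map fst couples @ map snd couples) \<and>
     set (singles @ map fst couples @ map snd couples) = {..<length eps} \<and>
     (\<forall>(i, j) \<in> set couples. eps ! i = 1 \<and> eps ! j = -1)"

text \<open>The blocks of a pair of matrices in canonical form, with \<open>q\<close> nonzero eigenvalues, in the
  order given by the pairing: the zero blocks come at positions \<open>q, q + 1, \<dots>\<close> of the
  canonical form and are moved to the front. As all blocks have size one, permuting blocks is
  permuting indices.\<close>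

definition segre_order :: "nat \<Rightarrow> nat list \<Rightarrow> (nat \<times> nat) list \<Rightarrow> nat list" where
  "segre_order q singles couples =
     map (\<lambda>i. q + i) (singles @ concat (map (\<lambda>(i, j). [i, j]) couples)) @ [0..<q]"

definition reorder_mat :: "nat list \<Rightarrow> complex mat \<Rightarrow> complex mat" where
  "reorder_mat p M = mat (length p) (length p) (\<lambda>(i, j). M $$ (p ! i, p ! j))"

definition paired_B :: "nat \<Rightarrow> nat \<Rightarrow> real list \<Rightarrow> complex mat" where
  "paired_B l1 l2 lams =
     diag_block_mat (replicate l1 (jordan_block 1 0)
                     @ concat (replicate l2 [jordan_block 1 0, jordan_block 1 0])
                     @ map (\<lambda>l. jordan_block 1 (complex_of_real l)) lams)"

definition paired_H :: "complex list \<Rightarrow> nat \<Rightarrow> nat \<Rightarrow> complex mat" where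
  "paired_H ds l2 q =
     diag_block_mat (map (\<lambda>d. d \<cdot>\<^sub>m Q1) ds @ concat (replicate l2 [Q1, - Q1]) @ replicate q Q1)"

lemma diag_block_mat_1:
  assumes "\<forall>M \<in> set Ms. M \<in> carrier_mat 1 1"
  shows "diag_block_mat Ms =
    mat (length Ms) (length Ms) (\<lambda>(i, j). if i = j then Ms ! i $$ (0, 0) else 0)"
  using assms
proof (induction Ms)
  case Nil
  then show ?case by (intro eq_matI) auto
next
  case (Cons M Ms)
  then have M: "M \<in> carrier_mat 1 1" and IH: "diag_block_mat Ms =
    mat (length Ms) (length Ms) (\<lambda>(i, j). if i = j then Ms ! i $$ (0, 0) else 0)"
    by auto
  show ?case
    using M by (intro eq_matI) (auto simp: IH Let_def nth_Cons' less_Suc_eq_0_disj split: if_splits)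
qed

lemma reorder_diag:
  assumes "distinct p" "set p \<subseteq> {..<length Ms}" "\<forall>M \<in> set Ms. M \<in> carrier_mat 1 1"
  shows "reorder_mat p (diag_block_mat Ms) = diag_block_mat (map (\<lambda>i. Ms ! i) p)"
proof -
  have "\<forall>M \<in> set (map (\<lambda>i. Ms ! i) p). M \<in> carrier_mat 1 1"
    using assms by auto
  moreover have "\<And>i. i < length p \<Longrightarrow> p ! i < length Ms"
    using assms(2) by (meson lessThan_iff nth_mem subset_iff)
  ultimately show ?thesis
    using assms by (intro eq_matI)
      (auto simp: reorder_mat_def diag_block_mat_1 nth_eq_iff_index_eq)
qed

lemma segre_order_perm:
  assumes "segre_pairing eps singles couples"
  shows "distinct (segre_order q singles couples)"
    and "set (segre_order q singles couples) = {..<q + length eps}"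
proof -
  define c where "c = concat (map (\<lambda>(i, j). [i, j]) couples)"
  have "mset c = mset (map fst couples @ map snd couples)"
    unfolding c_def by (induction couples) auto
  then have m: "mset (singles @ c) = mset (singles @ map fst couples @ map snd couples)"
    by simp
  have d: "distinct (singles @ c)" and s: "set (singles @ c) = {..<length eps}"
    using assms mset_eq_imp_distinct_iff[OF m] mset_eq_setD[OF m]
    unfolding segre_pairing_def by simp_all
  show "distinct (segre_order q singles couples)"
    using d unfolding segre_order_def c_def[symmetric]
    by (auto simp: distinct_map inj_on_def)
  show "set (segre_order q singles couples) = {..<q + length eps}"
  proof -
    have "set (segre_order q singles couples) = (+) q ` {..<length eps} \<union> {0..<q}"
      unfolding segre_order_def c_def[symmetric] set_append[of "map _ _"] set_map s set_upt ..
    also have "(+) q ` {..<length eps} = {q..<q + length eps}"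
      by (simp add: lessThan_atLeast0 image_add_atLeastLessThan add.commute)
    also have "{q..<q + length eps} \<union> {0..<q} = {..<q + length eps}"
      by auto
    finally show ?thesis .
  qed
qed

text \<open>Every canonical form with a Segre pairing has the paired form after reordering; the
  signs of the unpaired blocks are those of the canonical form.\<close>

lemma paired_form:
  assumes cf: "canonical_form B H lams eps" and sp: "segre_pairing eps singles couples"
  shows "reorder_mat (segre_order (length lams) singles couples) B
           = paired_B (length singles) (length couples) lams"
    and "reorder_mat (segre_order (length lams) singles couples) H
           = paired_H (map (\<lambda>i. eps ! i) singles) (length couples) (length lams)"
proof -
  let ?q = "length lams"
  let ?c = "concat (map (\<lambda>(i, j). [i, j]) couples)"
  let ?J = "map (\<lambda>l. jordan_block 1 (complex_of_real l)) lams"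
  let ?Z = "replicate (length eps) (jordan_block 1 0) :: complex mat list"
  let ?E = "map (\<lambda>e. e \<cdot>\<^sub>m Q1) eps"
  note p = segre_order_perm[OF sp, of ?q]
  have lt: "i < length eps" if "i \<in> set singles" for i
    using sp that unfolding segre_pairing_def by auto
  have "set (map fst couples @ map snd couples) \<subseteq> {..<length eps}"
    using sp unfolding segre_pairing_def by auto
  then have ltc: "i < length eps \<and> j < length eps" if "(i, j) \<in> set couples" for i j
    using that by force
  have sg: "eps ! i = 1 \<and> eps ! j = -1" if "(i, j) \<in> set couples" for i j
    using sp that unfolding segre_pairing_def by auto
  have B: "B = diag_block_mat (?J @ ?Z)" and H: "H = diag_block_mat (replicate ?q Q1 @ ?E)"
    using cf unfolding canonical_form_def by auto
  have nJ: "map (\<lambda>i. (?J @ ?Z) ! i) [0..<?q] = ?J"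
    by (intro nth_equalityI) (auto simp: nth_append)
  have nQ: "map (\<lambda>i. (replicate ?q Q1 @ ?E) ! i) [0..<?q] = replicate ?q Q1"
    by (intro nth_equalityI) (auto simp: nth_append)
  have sZ: "map (\<lambda>i. (?J @ ?Z) ! (?q + i)) singles = replicate (length singles) (jordan_block 1 0)"
    using lt by (intro nth_equalityI) (auto simp: nth_append)
  have sE: "map (\<lambda>i. (replicate ?q Q1 @ ?E) ! (?q + i)) singles
      = map (\<lambda>d. d \<cdot>\<^sub>m Q1) (map (\<lambda>i. eps ! i) singles)"
    using lt by (intro nth_equalityI) (auto simp: nth_append)
  have c: "map f (concat (map (\<lambda>(i, j). [i, j]) cs)) = concat (replicate (length cs) [x, y])"
    if "\<forall>(i, j) \<in> set cs. f i = x \<and> f j = y"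
    for f :: "nat \<Rightarrow> complex mat" and x y and cs :: "(nat \<times> nat) list"
    using that by (induction cs) (simp_all add: case_prod_beta)
  have cZ: "map (\<lambda>i. (?J @ ?Z) ! (?q + i)) ?c
      = concat (replicate (length couples) [jordan_block 1 0, jordan_block 1 0])"
  proof (intro c ballI, clarify)
    fix i j assume "(i, j) \<in> set couples"
    from ltc[OF this] show "(?J @ ?Z) ! (?q + i) = jordan_block 1 0 \<and>
        (?J @ ?Z) ! (?q + j) = jordan_block 1 0"
      by (simp add: nth_append)
  qed
  have m1: "(-1) \<cdot>\<^sub>m Q1 = - Q1" and p1: "1 \<cdot>\<^sub>m Q1 = Q1"
    by (intro eq_matI; simp)+
  have cE: "map (\<lambda>i. (replicate ?q Q1 @ ?E) ! (?q + i)) ?c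
      = concat (replicate (length couples) [Q1, - Q1])"
  proof (intro c ballI, clarify)
    fix i j assume "(i, j) \<in> set couples"
    from ltc[OF this] sg[OF this] show "(replicate ?q Q1 @ ?E) ! (?q + i) = Q1 \<and>
        (replicate ?q Q1 @ ?E) ! (?q + j) = - Q1"
      by (simp add: nth_append m1[simplified] p1[simplified])
  qed
  have cB: "\<forall>M \<in> set (?J @ ?Z). M \<in> carrier_mat 1 1"
    by (simp add: ball_Un)
  have cH: "\<forall>M \<in> set (replicate ?q Q1 @ ?E). M \<in> carrier_mat 1 1"
    by (simp add: ball_Un)
  have pB: "set (segre_order ?q singles couples) \<subseteq> {..<length (?J @ ?Z)}"
    unfolding p(2) by simp
  have pH: "set (segre_order ?q singles couples) \<subseteq> {..<length (replicate ?q Q1 @ ?E)}"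
    unfolding p(2) by simp
  show "reorder_mat (segre_order ?q singles couples) B
           = paired_B (length singles) (length couples) lams"
    unfolding B reorder_diag[OF p(1) pB cB]
    unfolding segre_order_def paired_B_def map_append map_map comp_def nJ sZ cZ
    by (simp only: append_assoc)
  show "reorder_mat (segre_order ?q singles couples) H
           = paired_H (map (\<lambda>i. eps ! i) singles) (length couples) ?q"
    unfolding H reorder_diag[OF p(1) pH cH]
    unfolding segre_order_def paired_H_def map_append map_map comp_def nQ sE cE
    by (simp only: append_assoc map_map comp_def)
qed

end

theory Submission
  imports Defs "Jordan_Normal_Form.Spectral_Radius" "HOL-Analysis.L2_Norm"
begin

text \<open>In terms of the signs of the canonical form, the right-hand side of the theorem says that
  every zero block carries the sign \<open>+1\<close>, i.e. that \<open>H\<close> is the identity: a pair \<open>(1,1)\<close> always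
  contributes a sign \<open>-1\<close>, and a pair \<open>(1,0)\<close> contributes the sign \<open>\<delta>\<^sub>i\<close>. So the theorem splits into
  two facts.

  If some zero block has sign \<open>-1\<close>, its basis vector \<open>v\<close> satisfies \<open>B v = 0\<close> and \<open>[v, v] < 0\<close>. For
  small \<open>c > 0\<close> the matrix \<open>B' x = B x + c [x, v] v\<close> is \<open>H\<close>-nonnegative, is close to \<open>B\<close>, and has \<open>v\<close>
  as an eigenvector for the negative eigenvalue \<open>c [v, v]\<close>. Such a \<open>B'\<close> has no \<open>H\<close>-nonnegative square
  root at all, because the square of an \<open>H\<close>-nonnegative matrix can have a negative eigenvalue only
  on isotropic vectors (\<open>H_nonneg_square_negative_eigenvector_isotropic\<close>). Thus no square root of
  \<open>B\<close> is unconditionally stable.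

  If \<open>H = I\<close>, then \<open>H\<close>-nonnegative means positive semidefinite, and the claim is the continuity at
  the diagonal matrix \<open>B\<close> of the positive semidefinite square root. Its existence is read off from a
  unitary diagonalization. For the continuity put \<open>D = S - T\<close> with \<open>S\<close> and \<open>T\<close> the square roots of \<open>B\<close>
  and \<open>B'\<close>; then \<open>B - B' = S D + D T\<close>. Pairing this with \<open>D\<close> in the trace inner product and
  dropping the nonnegative contribution of \<open>D T\<close> bounds the rows of \<open>D\<close> where the diagonal entry of
  \<open>S\<close> is positive. In the other rows \<open>D\<close> agrees with \<open>-T\<close>, and the squared norm of the \<open>i\<close>-th row
  of \<open>T\<close> is the \<open>i\<close>-th diagonal entry of \<open>T\<^sup>2 = B'\<close>, hence small as well
  (\<open>psd_sqrt_perturbation_bound\<close>).\<close>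

section \<open>Adjoints and the indefinite inner product\<close>

lemma mat_adjoint_carrier:
  "A \<in> carrier_mat m n \<Longrightarrow> mat_adjoint A \<in> carrier_mat n m"
  by (auto simp: mat_adjoint_def mat_of_rows_def)

lemma dim_mat_adjoint [simp]:
  "dim_row (mat_adjoint A) = dim_col A" "dim_col (mat_adjoint A) = dim_row A"
  by (auto simp: mat_adjoint_def mat_of_rows_def)

lemma index_mat_adjoint [simp]:
  "i < dim_col A \<Longrightarrow> j < dim_row A \<Longrightarrow> mat_adjoint A $$ (i, j) = conjugate (A $$ (j, i))"
  by (simp add: mat_adjoint_def mat_of_rows_def)

lemma mat_adjoint_adjoint [simp]: "mat_adjoint (mat_adjoint A) = A"
  by (intro eq_matI) auto

lemma mat_adjoint_mult:
  fixes A B :: "complex mat"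
  assumes "A \<in> carrier_mat m k" "B \<in> carrier_mat k n"
  shows "mat_adjoint (A * B) = mat_adjoint B * mat_adjoint A"
  using assms by (intro eq_matI) (auto simp: scalar_prod_def mult.commute)

lemma mult_mat_vec_cscalar_prod:
  fixes A :: "complex mat"
  assumes "A \<in> carrier_mat m n" "x \<in> carrier_vec n" "y \<in> carrier_vec m"
  shows "(A *\<^sub>v x) \<bullet>c y = x \<bullet>c (mat_adjoint A *\<^sub>v y)"
proof -
  have "(A *\<^sub>v x) \<bullet>c y = (\<Sum>i<m. \<Sum>j<n. A $$ (i, j) * x $ j * cnj (y $ i))"
    using assms by (simp add: scalar_prod_def sum_distrib_right lessThan_atLeast0)
  also have "\<dots> = (\<Sum>j<n. \<Sum>i<m. A $$ (i, j) * x $ j * cnj (y $ i))"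
    by (rule sum.swap)
  also have "\<dots> = x \<bullet>c (mat_adjoint A *\<^sub>v y)"
    using assms by (simp add: scalar_prod_def sum_distrib_left lessThan_atLeast0 ac_simps)
  finally show ?thesis .
qed

lemma cscalar_prod_commute:
  fixes x y :: "complex vec"
  assumes "x \<in> carrier_vec n" "y \<in> carrier_vec n"
  shows "y \<bullet>c x = cnj (x \<bullet>c y)"
  using assms by (simp add: scalar_prod_def mult.commute)

lemma ip_H_add_left:
  assumes "H \<in> carrier_mat n n" "x \<in> carrier_vec n" "y \<in> carrier_vec n" "z \<in> carrier_vec n"
  shows "ip_H H (x + y) z = ip_H H x z + ip_H H y z"
  using assms by (simp add: ip_H_def mult_add_distrib_mat_vec[of H n n] add_scalar_prod_distrib[of _ n])

lemma ip_H_smult_left: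
  assumes "H \<in> carrier_mat n n" "x \<in> carrier_vec n" "z \<in> carrier_vec n"
  shows "ip_H H (c \<cdot>\<^sub>v x) z = c * ip_H H x z"
  using assms by (simp add: ip_H_def mult_mat_vec[of H n n])

lemma ip_H_add_right:
  assumes "H \<in> carrier_mat n n" "x \<in> carrier_vec n" "y \<in> carrier_vec n" "z \<in> carrier_vec n"
  shows "ip_H H z (x + y) = ip_H H z x + ip_H H z y"
  using assms by (simp add: ip_H_def conjugate_add_vec[of _ n] scalar_prod_add_distrib[of _ n])

lemma ip_H_smult_right:
  assumes "H \<in> carrier_mat n n" "x \<in> carrier_vec n" "z \<in> carrier_vec n"
  shows "ip_H H z (c \<cdot>\<^sub>v x) = cnj c * ip_H H z x"
  using assms by (simp add: ip_H_def conjugate_smult_vec)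

lemma ip_H_commute:
  assumes "H \<in> carrier_mat n n" "mat_adjoint H = H" "x \<in> carrier_vec n" "y \<in> carrier_vec n"
  shows "ip_H H y x = cnj (ip_H H x y)"
proof -
  have "ip_H H y x = y \<bullet>c (H *\<^sub>v x)"
    using mult_mat_vec_cscalar_prod[of H n n y x] assms by (simp add: ip_H_def)
  also have "\<dots> = cnj (ip_H H x y)"
    unfolding ip_H_def using assms by (intro cscalar_prod_commute[of _ n]) auto
  finally show ?thesis .
qed

text \<open>Over the complex numbers a form with real values on the diagonal is Hermitian; this is the
  polarization identity, read at \<open>x + y\<close> and \<open>x + \<i> y\<close>. Here the
  form is \<open>[A x, y]\<close>.\<close>

lemma H_nonneg_self_adjoint:
  assumes H: "H \<in> carrier_mat n n" and A: "H_nonneg n H A"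
    and x: "x \<in> carrier_vec n" and y: "y \<in> carrier_vec n"
  shows "ip_H H (A *\<^sub>v y) x = cnj (ip_H H (A *\<^sub>v x) y)"
proof -
  have Ac: "A \<in> carrier_mat n n" and nn: "\<And>z. z \<in> carrier_vec n \<Longrightarrow> 0 \<le> ip_H H (A *\<^sub>v z) z"
    using A by (auto simp: H_nonneg_def)
  note lin = mult_add_distrib_mat_vec[OF Ac] mult_mat_vec[OF Ac]
    ip_H_add_left[OF H] ip_H_add_right[OF H] ip_H_smult_left[OF H] ip_H_smult_right[OF H]
  let ?a = "ip_H H (A *\<^sub>v x) y" and ?b = "ip_H H (A *\<^sub>v y) x"
  have "Im (ip_H H (A *\<^sub>v x) x) = 0" "Im (ip_H H (A *\<^sub>v y) y) = 0"
    using nn[OF x] nn[OF y] by (auto simp: less_eq_complex_def)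
  moreover have "Im (ip_H H (A *\<^sub>v x) x + ?a + ?b + ip_H H (A *\<^sub>v y) y) = 0"
    using nn[of "x + y"] x y Ac by (simp add: lin less_eq_complex_def)
  moreover have "Im (ip_H H (A *\<^sub>v x) x - \<i> * ?a + \<i> * ?b + ip_H H (A *\<^sub>v y) y) = 0"
    using nn[of "x + \<i> \<cdot>\<^sub>v y"] x y Ac by (simp add: lin less_eq_complex_def)
  ultimately show ?thesis by (simp add: complex_eq_iff)
qed

section \<open>A kernel vector of negative square destroys stability\<close>

text \<open>Put \<open>y = A x\<close>, so that \<open>A y = -t x\<close>. Nonnegativity at \<open>x\<close> and at \<open>y\<close> gives \<open>[y, x] \<ge> 0\<close> and
  \<open>-t [x, y] \<ge> 0\<close>, so \<open>[x, y] = 0\<close>. The form \<open>[A z, z]\<close> on the span of \<open>x\<close> and \<open>y\<close> is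
  thereby purely off-diagonal, with entry \<open>[y, y] = -t [x, x]\<close>; a semidefinite form of this kind
  vanishes.\<close>

lemma H_nonneg_square_negative_eigenvector_isotropic:
  assumes H: "H \<in> carrier_mat n n" "mat_adjoint H = H" and A: "H_nonneg n H A"
    and x: "x \<in> carrier_vec n" and eig: "A *\<^sub>v (A *\<^sub>v x) = complex_of_real (- t) \<cdot>\<^sub>v x"
    and t: "0 < t"
  shows "ip_H H x x = 0"
proof -
  have Ac: "A \<in> carrier_mat n n" and nn: "\<And>z. z \<in> carrier_vec n \<Longrightarrow> 0 \<le> ip_H H (A *\<^sub>v z) z"
    using A by (auto simp: H_nonneg_def)
  define y where "y = A *\<^sub>v x"
  have y: "y \<in> carrier_vec n" using Ac x by (simp add: y_def)
  have Ay: "A *\<^sub>v y = complex_of_real (- t) \<cdot>\<^sub>v x" using eig by (simp add: y_def)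
  note lin = mult_add_distrib_mat_vec[OF Ac] mult_mat_vec[OF Ac]
    ip_H_add_left[OF H(1)] ip_H_add_right[OF H(1)] ip_H_smult_left[OF H(1)] ip_H_smult_right[OF H(1)]
  define p where "p = ip_H H y x"
  have p: "0 \<le> p" using nn[OF x] by (simp add: p_def y_def)
  have xy: "ip_H H x y = p"
    using ip_H_commute[OF H y x] p by (auto simp: p_def complex_eq_iff less_eq_complex_def)
  have "0 \<le> complex_of_real (- t) * p"
    using nn[OF y] x y xy unfolding Ay by (simp add: lin)
  with p t have p0: "p = 0"
    by (auto simp: less_eq_complex_def complex_eq_iff mult_le_0_iff)
  have xr: "Im (ip_H H x x) = 0"
    using arg_cong[OF ip_H_commute[OF H x x], of Im] by simp
  have yy: "ip_H H y y = complex_of_real (- t) * ip_H H x x"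
    using H_nonneg_self_adjoint[OF H(1) A x y] x y xr unfolding Ay
    by (simp add: lin y_def[symmetric] complex_eq_iff)
  have q: "0 \<le> - s * (2 * t) * Re (ip_H H x x)" if "s = 1 \<or> s = -1" for s :: real
    using nn[of "x + complex_of_real s \<cdot>\<^sub>v y"] x y Ac that p0
    by (auto simp: lin Ay y_def[symmetric] yy xy p_def[symmetric] less_eq_complex_def)
  have "Re (ip_H H x x) = 0"
    using q[of 1] q[of "-1"] t by (simp add: mult_le_0_iff zero_le_mult_iff)
  with xr show ?thesis by (simp add: complex_eq_iff)
qed

lemma mat_norm_smult: "mat_norm (c \<cdot>\<^sub>m M) = cmod c * mat_norm M"
  by (simp add: mat_norm_def norm_mult power_mult_distrib sum_distrib_left[symmetric]
      real_sqrt_mult)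

lemma mat_norm_nonneg: "0 \<le> mat_norm M"
  by (simp add: mat_norm_def sum_nonneg)

text \<open>The perturbation \<open>R x = [x, v] v\<close> is \<open>H\<close>-nonnegative because \<open>[R x, x] = |[x, v]|\<^sup>2\<close>,
  whatever the sign of \<open>[v, v]\<close>; when that sign is negative, \<open>B + c R\<close> has the negative eigenvalue
  \<open>c [v, v]\<close> at \<open>v\<close>.\<close>

lemma not_unconditionally_stable_if_negative_kernel_vector:
  assumes H: "H \<in> carrier_mat n n" "mat_adjoint H = H" and B: "H_nonneg n H B"
    and v: "v \<in> carrier_vec n" and Bv: "B *\<^sub>v v = 0\<^sub>v n" and neg: "ip_H H v v < 0"
  shows "\<not> unconditionally_stable n H B A"
proof
  assume "unconditionally_stable n H B A"
  then have "\<forall>\<epsilon>>0. \<exists>\<delta>>0. \<forall>B'. H_nonneg n H B' \<and> mat_norm (B - B') < \<delta> \<longrightarrow>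
      (\<exists>A'. H_nonneg_sqrt n H B' A' \<and> mat_norm (A - A') < \<epsilon>)"
    by (simp add: unconditionally_stable_def)
  from this[rule_format, of 1]
  obtain \<delta> where \<delta>: "0 < \<delta>" and near: "\<forall>B'. H_nonneg n H B' \<and> mat_norm (B - B') < \<delta> \<longrightarrow>
      (\<exists>A'. H_nonneg_sqrt n H B' A' \<and> mat_norm (A - A') < 1)"
    by auto
  have Bc: "B \<in> carrier_mat n n" using B by (simp add: H_nonneg_def)
  define R where "R = mat n n (\<lambda>(i, j). v $ i * cnj ((H *\<^sub>v v) $ j))"
  have Rc: "R \<in> carrier_mat n n" by (simp add: R_def)
  have Rx: "R *\<^sub>v x = ip_H H x v \<cdot>\<^sub>v v" if x: "x \<in> carrier_vec n" for x
  proof -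
    have "R *\<^sub>v x = (x \<bullet>c (H *\<^sub>v v)) \<cdot>\<^sub>v v"
      using H x v by (intro eq_vecI)
        (auto simp: R_def scalar_prod_def sum_distrib_right sum_distrib_left ac_simps)
    also have "x \<bullet>c (H *\<^sub>v v) = ip_H H x v"
      using mult_mat_vec_cscalar_prod[OF H(1) x v] H by (simp add: ip_H_def)
    finally show ?thesis .
  qed
  \<comment> \<open>The summand \<open>1\<close> makes the denominator positive without an appeal to \<open>R \<noteq> 0\<close>.\<close>
  define c where "c = \<delta> / (2 * (1 + mat_norm R))"
  have c: "0 < c" using \<delta> mat_norm_nonneg[of R] by (simp add: c_def)
  define B' where "B' = B + complex_of_real c \<cdot>\<^sub>m R"
  have B'x: "B' *\<^sub>v x = B *\<^sub>v x + (complex_of_real c * ip_H H x v) \<cdot>\<^sub>v v" if x: "x \<in> carrier_vec n" for x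
  proof -
    have "(complex_of_real c \<cdot>\<^sub>m R) *\<^sub>v x = complex_of_real c \<cdot>\<^sub>v (R *\<^sub>v x)"
      using Rc x by (intro eq_vecI) auto
    then show ?thesis
      using x Rc Bc by (simp add: B'_def add_mult_distrib_mat_vec[of B n n] Rx smult_smult_assoc)
  qed
  have "H_nonneg n H B'"
    unfolding H_nonneg_def
  proof (intro conjI ballI)
    show "B' \<in> carrier_mat n n" using Bc Rc by (simp add: B'_def)
    fix x :: "complex vec" assume x: "x \<in> carrier_vec n"
    have "ip_H H (B' *\<^sub>v x) x = ip_H H (B *\<^sub>v x) x + complex_of_real c * (ip_H H x v * ip_H H v x)"
      using H x v Bc by (simp add: B'x ip_H_add_left[of H n] ip_H_smult_left[of H n])
    also have "ip_H H x v * ip_H H v x = complex_of_real ((cmod (ip_H H x v))\<^sup>2)"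
      unfolding ip_H_commute[OF H x v] by (rule complex_norm_square[symmetric])
    finally show "0 \<le> ip_H H (B' *\<^sub>v x) x"
      using B x c by (simp add: H_nonneg_def less_eq_complex_def)
  qed
  moreover have "mat_norm (B - B') < \<delta>"
  proof -
    have "B - B' = complex_of_real (- c) \<cdot>\<^sub>m R"
      using Bc Rc by (intro eq_matI) (auto simp: B'_def)
    then have "mat_norm (B - B') = c * mat_norm R"
      using c by (simp only: mat_norm_smult norm_of_real abs_minus_cancel abs_of_pos)
    also have "\<dots> \<le> \<delta> / 2"
      using \<delta> mat_norm_nonneg[of R] by (simp add: c_def field_simps)
    finally show ?thesis using \<delta> by simp
  qed
  ultimately obtain A' where A': "H_nonneg n H A'" and sq: "A' * A' = B'"
    using near unfolding H_nonneg_sqrt_def by blast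
  have A'c: "A' \<in> carrier_mat n n" using A' by (simp add: H_nonneg_def)
  have "Im (ip_H H v v) = 0" and r: "Re (ip_H H v v) < 0"
    using neg by (auto simp: less_complex_def)
  then have vv: "ip_H H v v = complex_of_real (Re (ip_H H v v))"
    by (simp add: complex_eq_iff)
  have "A' *\<^sub>v (A' *\<^sub>v v) = B' *\<^sub>v v"
    using A'c v by (simp add: sq[symmetric])
  also have "\<dots> = complex_of_real (- (- c * Re (ip_H H v v))) \<cdot>\<^sub>v v"
    using v vv by (simp add: B'x Bv)
  finally have "ip_H H v v = 0"
    by (rule H_nonneg_square_negative_eigenvector_isotropic[OF H A' v])
      (use c r in \<open>simp add: mult_pos_neg\<close>)
  with neg show False by simp
qed


section \<open>Unitary diagonalization of Hermitian matrices\<close>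

text \<open>Gram-Schmidt keeps the first vector of a basis and returns an orthogonal but not normalized
  basis; dividing by the lengths makes the matrix of columns unitary and turns \<open>v\<close> into a multiple
  of itself.\<close>

lemma exists_unitary_with_first_column:
  fixes v :: "complex vec"
  assumes v: "v \<in> carrier_vec n" and v0: "v \<noteq> 0\<^sub>v n"
  obtains W c where "W \<in> carrier_mat n n" "mat_adjoint W * W = 1\<^sub>m n" "col W 0 = c \<cdot>\<^sub>v v"
proof -
  have n: "0 < n" using v v0 by (cases n) auto
  interpret cof_vec_space n "TYPE(complex)" .
  define b where "b = basis_completion v"
  define ws where "ws = gram_schmidt n b"
  from basis_completion[OF v v0, folded b_def]
  have dist_b: "distinct b" and indep: "\<not> lin_dep (set b)" and b: "set b \<subseteq> carrier_vec n"
    and hdb: "hd b = v" and len_b: "length b = n" by auto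
  obtain vs where bv: "b = v # vs" using hdb len_b n by (cases b) auto
  from gram_schmidt_result[OF b dist_b indep refl, folded ws_def]
  have ws: "set ws \<subseteq> carrier_vec n" "corthogonal ws" "length ws = n"
    by (auto simp: len_b)
  have "hd ws = v" using gram_schmidt_hd[OF v, of vs, folded bv] by (simp add: ws_def)
  then have ws0: "ws ! 0 = v" using ws(3) n by (cases ws) auto
  have wsc: "ws ! i \<in> carrier_vec n" if "i < n" for i using ws that by auto
  define r where "r i = complex_of_real (1 / sqrt (Re (ws ! i \<bullet>c ws ! i)))" for i
  define W where "W = mat n n (\<lambda>(i, j). r j * ws ! j $ i)"
  have rc: "cnj (r i) = r i" for i by (simp add: r_def)
  have rr: "r i * r i * (ws ! i \<bullet>c ws ! i) = 1" if i: "i < n" for i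
  proof -
    have "ws ! i \<bullet>c ws ! i \<noteq> 0" using corthogonalD[OF ws(2), of i i] ws(3) i by auto
    moreover have "0 \<le> ws ! i \<bullet>c ws ! i" by (rule conjugate_square_ge_0_vec)
    ultimately obtain a where "ws ! i \<bullet>c ws ! i = complex_of_real a" "0 < a"
      by (intro that[of "Re (ws ! i \<bullet>c ws ! i)"])
        (auto simp: less_eq_complex_def complex_eq_iff less_le)
    then show ?thesis by (simp add: r_def of_real_mult[symmetric] del: of_real_mult)
  qed
  have "mat_adjoint W * W = 1\<^sub>m n"
  proof (intro eq_matI)
    fix i j assume "i < dim_row (1\<^sub>m n :: complex mat)" "j < dim_col (1\<^sub>m n :: complex mat)"
    then have i: "i < n" and j: "j < n" by auto
    have "(mat_adjoint W * W) $$ (i, j) = r i * r j * (ws ! j \<bullet>c ws ! i)"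
      using i j wsc[OF i] wsc[OF j]
      by (simp add: W_def scalar_prod_def sum_distrib_left rc ac_simps)
    also have "\<dots> = (if i = j then 1 else 0)"
      using corthogonalD[OF ws(2), of j i] ws(3) i j rr by auto
    finally show "(mat_adjoint W * W) $$ (i, j) = 1\<^sub>m n $$ (i, j)" using i j by simp
  qed (simp_all add: W_def)
  moreover have "col W 0 = r 0 \<cdot>\<^sub>v v"
    using n v by (intro eq_vecI) (auto simp: W_def ws0)
  ultimately show ?thesis using that[of W "r 0"] by (simp add: W_def)
qed

lemma mat_adjoint_four_block:
  fixes A :: "complex mat"
  assumes "A \<in> carrier_mat k k" "D \<in> carrier_mat n n"
  shows "mat_adjoint (four_block_mat A (0\<^sub>m k n) (0\<^sub>m n k) D) =
    four_block_mat (mat_adjoint A) (0\<^sub>m k n) (0\<^sub>m n k) (mat_adjoint D)"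
  using assms by (intro eq_matI) auto

lemma four_block_diag_mult:
  fixes A :: "complex mat"
  assumes "A \<in> carrier_mat k k" "D \<in> carrier_mat n n" "A' \<in> carrier_mat k k" "D' \<in> carrier_mat n n"
  shows "four_block_mat A (0\<^sub>m k n) (0\<^sub>m n k) D * four_block_mat A' (0\<^sub>m k n) (0\<^sub>m n k) D' =
    four_block_mat (A * A') (0\<^sub>m k n) (0\<^sub>m n k) (D * D')"
  using assms by (subst mult_four_block_mat[of _ k k _ n _ n _ _ k _ n]) auto

text \<open>Induction on the dimension. In an orthonormal basis that starts with an eigenvector, the
  first column of the matrix is a multiple of the first unit vector; by symmetry so is the first
  row, and the remaining block is Hermitian of smaller size.\<close>

theorem hermitian_unitary_diagonalization:
  fixes A :: "complex mat"
  assumes "A \<in> carrier_mat n n" "mat_adjoint A = A"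
  shows "\<exists>U d. U \<in> carrier_mat n n \<and> mat_adjoint U * U = 1\<^sub>m n \<and>
    A = U * mat_diag n d * mat_adjoint U"
  using assms
proof (induction n arbitrary: A)
  case 0
  then show ?case by (intro exI[of _ "1\<^sub>m 0"] exI[of _ "\<lambda>_. 0"]) (auto intro!: eq_matI)
next
  case (Suc n A)
  let ?N = "Suc n"
  note A = Suc.prems(1)
  note assoc = assoc_mult_mat[of _ ?N ?N _ ?N _ ?N]
  obtain e v where "eigenvector A v e"
    using spectrum_non_empty[OF A] by (auto simp: spectrum_def eigenvalue_def)
  then have v: "v \<in> carrier_vec ?N" and v0: "v \<noteq> 0\<^sub>v ?N" and Av: "A *\<^sub>v v = e \<cdot>\<^sub>v v"
    using A by (auto simp: eigenvector_def)
  obtain W c where W: "W \<in> carrier_mat ?N ?N" and WW: "mat_adjoint W * W = 1\<^sub>m ?N"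
    and W0: "col W 0 = c \<cdot>\<^sub>v v"
    by (rule exists_unitary_with_first_column[OF v v0])
  have W': "mat_adjoint W \<in> carrier_mat ?N ?N" by (rule mat_adjoint_carrier[OF W])
  have WW': "W * mat_adjoint W = 1\<^sub>m ?N" by (rule mat_mult_left_right_inverse[OF W' W WW])
  have cW: "col W 0 \<in> carrier_vec ?N" using v by (simp add: W0)
  define C where "C = mat_adjoint W * (A * W)"
  have C: "C \<in> carrier_mat ?N ?N" using mult_carrier_mat[OF W' mult_carrier_mat[OF A W]] by (simp add: C_def)
  have C_herm: "mat_adjoint C = C"
    using W W' A Suc.prems(2)
    by (simp add: C_def mat_adjoint_mult[OF W' mult_carrier_mat[OF A W]] mat_adjoint_mult[OF A W]
        assoc)
  have "col C 0 = mat_adjoint W *\<^sub>v (A *\<^sub>v col W 0)"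
    unfolding C_def using col_mult2[OF W' mult_carrier_mat[OF A W]] col_mult2[OF A W] by simp
  also have "A *\<^sub>v col W 0 = e \<cdot>\<^sub>v col W 0"
    using A v by (simp add: W0 mult_mat_vec Av smult_smult_assoc mult.commute)
  also have "mat_adjoint W *\<^sub>v (e \<cdot>\<^sub>v col W 0) = e \<cdot>\<^sub>v col (mat_adjoint W * W) 0"
    by (simp add: mult_mat_vec[OF W' cW] col_mult2[OF W' W])
  finally have C0: "col C 0 = e \<cdot>\<^sub>v unit_vec ?N 0" by (simp add: WW)
  have Ci0: "C $$ (i, 0) = (if i = 0 then e else 0)" if "i < ?N" for i
    using arg_cong[OF C0, of "\<lambda>x. x $ i"] C that by simp
  have C0i: "C $$ (0, i) = (if i = 0 then e else 0)" if i: "i < ?N" for i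
  proof (cases "i = 0")
    case False
    have "C $$ (0, i) = cnj (C $$ (i, 0))"
      using arg_cong[OF C_herm, of "\<lambda>M. M $$ (0, i)"] C i by simp
    with Ci0[OF i] False show ?thesis by simp
  qed (use Ci0 in simp)
  define A3 where "A3 = mat n n (\<lambda>(i, j). C $$ (Suc i, Suc j))"
  have A3: "A3 \<in> carrier_mat n n" by (simp add: A3_def)
  have Cblock: "C = four_block_mat (mat_diag 1 (\<lambda>_. e)) (0\<^sub>m 1 n) (0\<^sub>m n 1) A3"
    using C Ci0 C0i by (intro eq_matI) (auto simp: A3_def mat_diag_def)
  have "mat_adjoint A3 = A3"
  proof (intro eq_matI)
    fix i j assume "i < dim_row A3" "j < dim_col A3"
    then have "i < n" "j < n" by (auto simp: A3_def)
    then show "mat_adjoint A3 $$ (i, j) = A3 $$ (i, j)"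
      using arg_cong[OF C_herm, of "\<lambda>M. M $$ (Suc i, Suc j)"] C by (simp add: A3_def)
  qed (auto simp: A3_def)
  from Suc.IH[OF A3 this] obtain U' d where U': "U' \<in> carrier_mat n n"
    and UU': "mat_adjoint U' * U' = 1\<^sub>m n" and A3_eq: "A3 = U' * mat_diag n d * mat_adjoint U'"
    by blast
  have U'': "mat_adjoint U' \<in> carrier_mat n n" by (rule mat_adjoint_carrier[OF U'])
  define V where "V = four_block_mat (1\<^sub>m 1) (0\<^sub>m 1 n) (0\<^sub>m n 1) U'"
  have V: "V \<in> carrier_mat ?N ?N" using four_block_carrier_mat[of "1\<^sub>m 1" 1 1 U' n n] U' by (simp add: V_def)
  have one_adj: "mat_adjoint (1\<^sub>m 1 :: complex mat) = 1\<^sub>m 1" by (intro eq_matI) auto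
  have V_adj: "mat_adjoint V = four_block_mat (1\<^sub>m 1) (0\<^sub>m 1 n) (0\<^sub>m n 1) (mat_adjoint U')"
    unfolding V_def using U' by (subst mat_adjoint_four_block) (auto simp: one_adj)
  have VV: "mat_adjoint V * V = 1\<^sub>m ?N"
    unfolding V_adj unfolding V_def using U' U'' UU' by (simp add: four_block_diag_mult)
  let ?D = "mat_diag ?N (case_nat e d)"
  have D: "?D = four_block_mat (mat_diag 1 (\<lambda>_. e)) (0\<^sub>m 1 n) (0\<^sub>m n 1) (mat_diag n d)"
    by (intro eq_matI) (auto simp: mat_diag_def split: nat.split)
  have Ceq: "C = V * ?D * mat_adjoint V"
    unfolding V_adj unfolding D V_def Cblock A3_eq
      four_block_diag_mult[OF one_carrier_mat U' mat_diag_dim mat_diag_dim]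
      left_mult_one_mat[OF mat_diag_dim]
      four_block_diag_mult[OF mat_diag_dim mult_carrier_mat[OF U' mat_diag_dim] one_carrier_mat U'']
      right_mult_one_mat[OF mat_diag_dim] ..
  have V': "mat_adjoint V \<in> carrier_mat ?N ?N" by (rule mat_adjoint_carrier[OF V])
  define U where "U = W * V"
  have "A = (W * mat_adjoint W) * A * (W * mat_adjoint W)"
    using A by (simp add: WW')
  also have "\<dots> = W * C * mat_adjoint W"
    using A W W' by (simp add: C_def assoc)
  also have "\<dots> = U * ?D * mat_adjoint U"
  proof -
    define F where "F = ?D"
    have "F \<in> carrier_mat ?N ?N" by (simp add: F_def)
    then show ?thesis
      using W V W' V' unfolding Ceq F_def[symmetric] U_def mat_adjoint_mult[OF W V] by (simp add: assoc)
  qed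
  finally have "A = U * ?D * mat_adjoint U" .
  moreover have "mat_adjoint U * U = mat_adjoint V * (mat_adjoint W * W) * V"
    using W V W' V' by (simp add: U_def mat_adjoint_mult[OF W V] assoc)
  then have "mat_adjoint U * U = 1\<^sub>m ?N" using V V' by (simp add: WW VV)
  moreover have "U \<in> carrier_mat ?N ?N" using W V by (simp add: U_def)
  ultimately show ?case by blast
qed

section \<open>Square roots of positive semidefinite matrices\<close>

lemma mat_mult_unit_vec:
  fixes A :: "'a :: semiring_1 mat"
  assumes "A \<in> carrier_mat m n" "i < n"
  shows "A *\<^sub>v unit_vec n i = col A i"
  using assms by (intro eq_vecI) (auto simp: scalar_prod_right_unit)

lemma ip_H_one: "x \<in> carrier_vec n \<Longrightarrow> ip_H (1\<^sub>m n) x y = x \<bullet>c y"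
  by (simp add: ip_H_def)

lemma psd_hermitian:
  assumes B: "H_nonneg n (1\<^sub>m n) B"
  shows "mat_adjoint B = B"
proof -
  have Bc: "B \<in> carrier_mat n n" using B by (simp add: H_nonneg_def)
  have entry: "ip_H (1\<^sub>m n) (B *\<^sub>v unit_vec n j) (unit_vec n i) = B $$ (i, j)"
    if "i < n" "j < n" for i j
  proof -
    have "conjugate (unit_vec n i :: complex vec) = unit_vec n i"
      by (intro eq_vecI) (auto simp: unit_vec_def)
    then show ?thesis using Bc that by (simp add: ip_H_one[of _ n] mat_mult_unit_vec)
  qed
  show ?thesis
  proof (intro eq_matI)
    fix i j assume "i < dim_row B" "j < dim_col B"
    then have ij: "i < n" "j < n" using Bc by auto
    have "B $$ (i, j) = cnj (B $$ (j, i))"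
      using H_nonneg_self_adjoint[OF _ B, of "unit_vec n i" "unit_vec n j"] ij by (simp add: entry)
    then show "mat_adjoint B $$ (i, j) = B $$ (i, j)" using ij Bc by simp
  qed (use Bc in auto)
qed

lemma mat_diag_mult_vec:
  fixes z :: "'a :: comm_semiring_0 vec"
  assumes "z \<in> carrier_vec n"
  shows "mat_diag n f *\<^sub>v z = vec n (\<lambda>i. f i * z $ i)"
proof (intro eq_vecI)
  fix i assume "i < dim_vec (vec n (\<lambda>i. f i * z $ i))"
  then have i: "i < n" by simp
  have "(mat_diag n f *\<^sub>v z) $ i = (\<Sum>j<n. (if i = j then f j else 0) * z $ j)"
    using assms i by (simp add: mat_diag_def scalar_prod_def lessThan_atLeast0)
  also have "\<dots> = f i * z $ i"
    using i by (simp add: if_distrib[of "\<lambda>x. x * _"] cong: if_cong)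
  finally show "(mat_diag n f *\<^sub>v z) $ i = vec n (\<lambda>i. f i * z $ i) $ i"
    using i by simp
qed (simp add: mat_diag_def)

lemma mat_diag_nonneg_quadratic_form:
  assumes "\<And>i. i < n \<Longrightarrow> 0 \<le> s i" and z: "z \<in> carrier_vec n"
  shows "0 \<le> (mat_diag n (\<lambda>i. complex_of_real (s i)) *\<^sub>v z) \<bullet>c z"
proof -
  have "(mat_diag n (\<lambda>i. complex_of_real (s i)) *\<^sub>v z) \<bullet>c z
      = (\<Sum>i<n. complex_of_real (s i) * (z $ i * cnj (z $ i)))"
    using z by (simp add: mat_diag_mult_vec) (simp add: scalar_prod_def lessThan_atLeast0 ac_simps)
  also have "\<dots> = complex_of_real (\<Sum>i<n. s i * (cmod (z $ i))\<^sup>2)"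
    by (simp only: complex_norm_square[symmetric] of_real_sum of_real_mult)
  moreover have "0 \<le> (\<Sum>i<n. s i * (cmod (z $ i))\<^sup>2)"
    using assms(1) by (intro sum_nonneg) simp
  ultimately show ?thesis by (simp add: less_eq_complex_def del: of_real_sum)
qed

lemma mat_diag_nonneg:
  assumes "\<And>i. i < n \<Longrightarrow> 0 \<le> s i"
  shows "H_nonneg n (1\<^sub>m n) (mat_diag n (\<lambda>i. complex_of_real (s i)))"
proof -
  have "(mat_diag n (\<lambda>i. complex_of_real (s i)) *\<^sub>v z) \<in> carrier_vec n" if "z \<in> carrier_vec n" for z
    by (rule mult_mat_vec_carrier[OF mat_diag_dim that])
  then show ?thesis
    using mat_diag_nonneg_quadratic_form[OF assms] by (simp add: H_nonneg_def ip_H_one)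
qed

lemma psd_sqrt_exists:
  assumes B: "H_nonneg n (1\<^sub>m n) B"
  shows "\<exists>A. H_nonneg_sqrt n (1\<^sub>m n) B A"
proof -
  note assoc = assoc_mult_mat[of _ n n _ n _ n]
  have Bc: "B \<in> carrier_mat n n" and nn: "\<And>z. z \<in> carrier_vec n \<Longrightarrow> 0 \<le> (B *\<^sub>v z) \<bullet>c z"
    using B by (auto simp: H_nonneg_def ip_H_one[of _ n])
  obtain U d where U: "U \<in> carrier_mat n n" and UU: "mat_adjoint U * U = 1\<^sub>m n"
    and Beq: "B = U * mat_diag n d * mat_adjoint U"
    using hermitian_unitary_diagonalization[OF Bc psd_hermitian[OF B]] by blast
  have U': "mat_adjoint U \<in> carrier_mat n n" by (rule mat_adjoint_carrier[OF U])
  have D: "mat_diag n f \<in> carrier_mat n n" for f :: "nat \<Rightarrow> complex" by simp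
  \<comment> \<open>The quadratic form of \<open>U F U\<^sup>*\<close> is that of the diagonal matrix \<open>F\<close> in the coordinates
      \<open>U\<^sup>* x\<close>. It is needed for \<open>B\<close>, to see that the eigenvalues are nonnegative, and for the root.\<close>
  have form: "(U * mat_diag n f * mat_adjoint U *\<^sub>v x) \<bullet>c x
      = (mat_diag n f *\<^sub>v (mat_adjoint U *\<^sub>v x)) \<bullet>c (mat_adjoint U *\<^sub>v x)"
    if x: "x \<in> carrier_vec n" for f x
  proof -
    have y: "mat_diag n f *\<^sub>v (mat_adjoint U *\<^sub>v x) \<in> carrier_vec n"
      using U' x by (intro mult_mat_vec_carrier[OF D]) auto
    have "U * mat_diag n f * mat_adjoint U *\<^sub>v x = U *\<^sub>v (mat_diag n f *\<^sub>v (mat_adjoint U *\<^sub>v x))"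
      using x by (simp add: assoc_mult_mat_vec[OF mult_carrier_mat[OF U D] U']
          assoc_mult_mat_vec[OF U D mult_mat_vec_carrier[OF U']])
    then show ?thesis using mult_mat_vec_cscalar_prod[OF U y x] by simp
  qed
  have d: "0 \<le> d i" if i: "i < n" for i
  proof -
    let ?e = "unit_vec n i :: complex vec"
    have e: "?e \<in> carrier_vec n" by simp
    have ec: "conjugate ?e = ?e" by (intro eq_vecI) (auto simp: unit_vec_def)
    have "mat_adjoint U *\<^sub>v (U *\<^sub>v ?e) = ?e"
      using U by (simp add: assoc_mult_mat_vec[OF U' U e, symmetric] UU)
    then have "(B *\<^sub>v (U *\<^sub>v ?e)) \<bullet>c (U *\<^sub>v ?e) = (mat_diag n d *\<^sub>v ?e) \<bullet>c ?e"
      unfolding Beq using form[of "U *\<^sub>v ?e" d] U by simp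
    also have "\<dots> = d i"
      using i by (simp add: ec mat_mult_unit_vec[OF D] scalar_prod_right_unit[of _ n]) (simp add: mat_diag_def)
    finally show ?thesis using nn[of "U *\<^sub>v ?e"] U by simp
  qed
  define s where "s i = sqrt (Re (d i))" for i
  have s: "0 \<le> s i" and ss: "complex_of_real (s i) * complex_of_real (s i) = d i" if "i < n" for i
    using d[OF that] by (auto simp: s_def less_eq_complex_def complex_eq_iff)
  define S where "S = mat_diag n (\<lambda>i. complex_of_real (s i))"
  have Sc: "S \<in> carrier_mat n n" by (simp add: S_def)
  have SS: "S * S = mat_diag n d"
    unfolding S_def mat_diag_diag using ss by (intro eq_matI) (auto simp: mat_diag_def)
  define A where "A = U * S * mat_adjoint U"
  have Ac: "A \<in> carrier_mat n n" using mult_carrier_mat[OF mult_carrier_mat[OF U Sc] U'] by (simp add: A_def)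
  have "A * A = U * S * (mat_adjoint U * U) * S * mat_adjoint U"
    using U U' Sc by (simp add: A_def assoc)
  also have "\<dots> = U * (S * S) * mat_adjoint U"
    using U U' Sc unfolding UU by (simp add: assoc)
  finally have "A * A = B" by (simp add: SS Beq)
  moreover have "H_nonneg n (1\<^sub>m n) A"
    unfolding H_nonneg_def
  proof (intro conjI ballI Ac)
    fix x :: "complex vec" assume x: "x \<in> carrier_vec n"
    have "ip_H (1\<^sub>m n) (A *\<^sub>v x) x = (A *\<^sub>v x) \<bullet>c x"
      using Ac x by (intro ip_H_one) simp
    also have "\<dots> = (S *\<^sub>v (mat_adjoint U *\<^sub>v x)) \<bullet>c (mat_adjoint U *\<^sub>v x)"
      unfolding A_def S_def by (rule form[OF x])
    also have "\<dots> \<ge> 0"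
      unfolding S_def using U' x by (intro mat_diag_nonneg_quadratic_form s) auto
    finally show "0 \<le> ip_H (1\<^sub>m n) (A *\<^sub>v x) x" .
  qed
  ultimately show ?thesis unfolding H_nonneg_sqrt_def by blast
qed

section \<open>Continuity of the square root at a diagonal matrix\<close>

lemma mat_norm_square:
  "M \<in> carrier_mat n n \<Longrightarrow> (mat_norm M)\<^sup>2 = (\<Sum>i<n. \<Sum>j<n. (cmod (M $$ (i, j)))\<^sup>2)"
  by (simp add: mat_norm_def sum_nonneg)

lemma mat_norm_L2_set:
  "M \<in> carrier_mat n n \<Longrightarrow> mat_norm M = L2_set (\<lambda>p. cmod (M $$ p)) ({..<n} \<times> {..<n})"
  by (simp add: mat_norm_def L2_set_def sum.cartesian_product)

text \<open>Cauchy-Schwarz for the trace inner product.\<close>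

lemma Re_entrywise_product_le_mat_norm:
  assumes M: "M \<in> carrier_mat n n" and N: "N \<in> carrier_mat n n"
  shows "(\<Sum>i<n. \<Sum>j<n. Re (cnj (M $$ (i, j)) * N $$ (i, j))) \<le> mat_norm M * mat_norm N"
proof -
  have "(\<Sum>i<n. \<Sum>j<n. Re (cnj (M $$ (i, j)) * N $$ (i, j)))
      = (\<Sum>p\<in>{..<n} \<times> {..<n}. Re (cnj (M $$ p) * N $$ p))"
    by (simp add: sum.cartesian_product)
  also have "\<dots> \<le> (\<Sum>p\<in>{..<n} \<times> {..<n}. \<bar>cmod (M $$ p)\<bar> * \<bar>cmod (N $$ p)\<bar>)"
    by (intro sum_mono) (metis abs_norm_cancel complex_Re_le_cmod complex_mod_cnj norm_mult)
  also have "\<dots> \<le> mat_norm M * mat_norm N"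
    unfolding mat_norm_L2_set[OF M] mat_norm_L2_set[OF N] by (rule L2_set_mult_ineq)
  finally show ?thesis .
qed

lemma cmod_entry_le_mat_norm:
  assumes M: "M \<in> carrier_mat n n" and "i < n" "j < n"
  shows "cmod (M $$ (i, j)) \<le> mat_norm M"
  unfolding mat_norm_L2_set[OF M] using assms
  by (intro member_le_L2_set[of _ "(i, j)" "\<lambda>p. cmod (M $$ p)"]) auto

text \<open>The square root is not Lipschitz at a singular matrix, so the bound has two parts: the rows of
  \<open>D = S - T\<close> with \<open>s i \<ge> m\<close> are controlled linearly in the distance of the squares, and the rows
  with \<open>s i = 0\<close> only by the square root of this distance. Both estimates are in the form
  \<open>r i \<le> c i / m + e\<close> below, where \<open>r i\<close> is the squared length of the \<open>i\<close>-th row of \<open>D\<close>, and \<open>c i\<close>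
  its pairing with the \<open>i\<close>-th row of \<open>E = S\<^sup>2 - T\<^sup>2\<close>.\<close>

lemma psd_sqrt_perturbation_bound:
  fixes n :: nat and s :: "nat \<Rightarrow> real"
  defines "S \<equiv> mat_diag n (\<lambda>i. complex_of_real (s i))"
  assumes T: "H_nonneg n (1\<^sub>m n) T" and m: "0 < m"
    and gap: "\<And>i. i < n \<Longrightarrow> s i = 0 \<or> m \<le> s i"
  shows "(mat_norm (S - T))\<^sup>2 \<le>
    mat_norm (S - T) * mat_norm (S * S - T * T) / m + real n * mat_norm (S * S - T * T)"
proof -
  have Tc: "T \<in> carrier_mat n n" and nn: "\<And>z. z \<in> carrier_vec n \<Longrightarrow> 0 \<le> (T *\<^sub>v z) \<bullet>c z"
    using T by (auto simp: H_nonneg_def ip_H_one[of _ n])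
  have Sc: "S \<in> carrier_mat n n" by (simp add: S_def)
  define D where "D = S - T"
  define E where "E = S * S - T * T"
  have Dc: "D \<in> carrier_mat n n" and Ec: "E \<in> carrier_mat n n"
    using Sc Tc by (auto simp: D_def E_def)
  have E_eq: "E = S * D + D * T"
    unfolding D_def E_def using Sc Tc
    by (simp add: mult_minus_distrib_mat[of _ n n _ n] minus_mult_distrib_mat[of _ n n _ _ n])
       (intro eq_matI; auto)
  have E_ij: "E $$ (i, j) = complex_of_real (s i) * D $$ (i, j) + (\<Sum>k<n. D $$ (i, k) * T $$ (k, j))"
    if "i < n" "j < n" for i j
    unfolding E_eq using that Dc Tc Sc
    by (simp add: S_def mat_diag_mult_left[OF Dc]) (simp add: scalar_prod_def lessThan_atLeast0)
  define e where "e = mat_norm E"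
  define r where "r i = (\<Sum>j<n. (cmod (D $$ (i, j)))\<^sup>2)" for i
  define c where "c i = (\<Sum>j<n. Re (cnj (D $$ (i, j)) * E $$ (i, j)))" for i
  \<comment> \<open>Row \<open>i\<close> of \<open>E = S D + D T\<close>, paired with row \<open>i\<close> of \<open>D\<close>: the term from \<open>D T\<close> is the quadratic form
      of \<open>T\<close> at the conjugate of that row.\<close>
  have sr: "s i * r i \<le> c i" if i: "i < n" for i
  proof -
    define x where "x = vec n (\<lambda>k. cnj (D $$ (i, k)))"
    have "(\<Sum>j<n. cnj (D $$ (i, j)) * E $$ (i, j)) =
        complex_of_real (s i) * (\<Sum>j<n. D $$ (i, j) * cnj (D $$ (i, j)))
        + (\<Sum>j<n. \<Sum>k<n. cnj (D $$ (i, j)) * (D $$ (i, k) * T $$ (k, j)))"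
      using i by (simp add: E_ij distrib_left sum.distrib sum_distrib_left ac_simps)
    also have "(\<Sum>j<n. D $$ (i, j) * cnj (D $$ (i, j))) = complex_of_real (r i)"
      by (simp only: r_def complex_norm_square[symmetric] of_real_sum)
    also have "(\<Sum>j<n. \<Sum>k<n. cnj (D $$ (i, j)) * (D $$ (i, k) * T $$ (k, j))) = (T *\<^sub>v x) \<bullet>c x"
      using Tc by (subst sum.swap)
        (simp add: x_def scalar_prod_def sum_distrib_left sum_distrib_right lessThan_atLeast0 ac_simps)
    finally have "c i = s i * r i + Re ((T *\<^sub>v x) \<bullet>c x)"
      by (simp only: c_def Re_sum[symmetric]) simp
    moreover have "0 \<le> Re ((T *\<^sub>v x) \<bullet>c x)"
      using nn[of x] by (simp add: x_def less_eq_complex_def)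
    ultimately show ?thesis by simp
  qed
  have r0: "0 \<le> r i" for i by (simp add: r_def sum_nonneg)
  have e0: "0 \<le> e" by (simp add: e_def mat_norm_nonneg)
  have row: "r i \<le> c i / m + e" if i: "i < n" for i
  proof (cases "s i = 0")
    case True
    have herm: "T $$ (j, i) = cnj (T $$ (i, j))" if "j < n" for j
      using arg_cong[OF psd_hermitian[OF T], of "\<lambda>M. M $$ (j, i)"] Tc i that by simp
    \<comment> \<open>Here row \<open>i\<close> of \<open>D\<close> is that of \<open>-T\<close>, whose squared length is a diagonal entry of \<open>T\<^sup>2\<close>.\<close>
    have "complex_of_real (r i) = (\<Sum>j<n. T $$ (i, j) * T $$ (j, i))"
    proof -
      have "D $$ (i, j) = - T $$ (i, j)" if "j < n" for j
        using Sc Tc i that True by (auto simp: D_def S_def mat_diag_def)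
      then show ?thesis
        unfolding r_def of_real_sum complex_norm_square by (intro sum.cong) (simp_all add: herm)
    qed
    also have "\<dots> = - E $$ (i, i)"
      using Sc Tc i True
      by (simp add: E_def S_def) (simp add: mat_diag_def scalar_prod_def lessThan_atLeast0)
    finally have "r i \<le> cmod (E $$ (i, i))"
      by (metis complex_Re_le_cmod norm_minus_cancel Re_complex_of_real)
    also have "\<dots> \<le> e" unfolding e_def by (rule cmod_entry_le_mat_norm[OF Ec i i])
    finally show ?thesis using sr[OF i] True m by (simp add: add_increasing)
  next
    case False
    then have "m * r i \<le> s i * r i" using gap[OF i] r0 by (intro mult_right_mono) auto
    with sr[OF i] have "r i \<le> c i / m" using m by (simp add: field_simps)
    with e0 show ?thesis by simp
  qed
  have "(mat_norm D)\<^sup>2 = (\<Sum>i<n. r i)" by (simp add: mat_norm_square[OF Dc] r_def)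
  also have "\<dots> \<le> (\<Sum>i<n. c i / m + e)" by (intro sum_mono row) simp
  also have "\<dots> = (\<Sum>i<n. c i) / m + real n * e" by (simp add: sum.distrib sum_divide_distrib)
  also have "\<dots> \<le> mat_norm D * e / m + real n * e"
    using Re_entrywise_product_le_mat_norm[OF Dc Ec] m
    by (simp add: c_def e_def divide_right_mono)
  finally show ?thesis by (simp add: D_def e_def E_def)
qed

lemma diagonal_psd_sqrt_unconditionally_stable:
  assumes s: "\<And>i. i < n \<Longrightarrow> 0 \<le> s i"
    and B: "B = mat_diag n (\<lambda>i. complex_of_real (s i * s i))"
  shows "unconditionally_stable n (1\<^sub>m n) B (mat_diag n (\<lambda>i. complex_of_real (s i)))"
proof -
  let ?S = "mat_diag n (\<lambda>i. complex_of_real (s i))"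
  have SS: "?S * ?S = B" by (simp add: B)
  \<comment> \<open>The smallest positive entry, capped at \<open>1\<close> to cover the case that there is none.\<close>
  define m where "m = Min (insert 1 (s ` {i. i < n \<and> 0 < s i}))"
  have m: "0 < m" by (auto simp: m_def)
  have gap: "s i = 0 \<or> m \<le> s i" if "i < n" for i
    using s[OF that] that by (auto simp: m_def less_le intro!: Min_le)
  show ?thesis
    unfolding unconditionally_stable_def
  proof (intro conjI allI impI)
    show "H_nonneg_sqrt n (1\<^sub>m n) B ?S"
      using mat_diag_nonneg[OF s] SS by (simp add: H_nonneg_sqrt_def)
    fix \<epsilon> :: real assume \<epsilon>: "0 < \<epsilon>"
    \<comment> \<open>If \<open>N \<ge> \<epsilon>\<close>, the bound \<open>N\<^sup>2 \<le> N e / m + n e\<close> implies \<open>N\<^sup>2 \<le> N e (1 / m + n / \<epsilon>)\<close>, so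
        \<open>\<epsilon> \<le> N \<le> e K\<close>.\<close>
    define K where "K = 1 / m + real n / \<epsilon>"
    have K: "0 < K" using m \<epsilon> by (simp add: K_def add_pos_nonneg)
    show "\<exists>\<delta>>0. \<forall>B'. H_nonneg n (1\<^sub>m n) B' \<and> mat_norm (B - B') < \<delta> \<longrightarrow>
        (\<exists>A'. H_nonneg_sqrt n (1\<^sub>m n) B' A' \<and> mat_norm (?S - A') < \<epsilon>)"
    proof (intro exI[of _ "\<epsilon> / K"] conjI allI impI)
      show "0 < \<epsilon> / K" using \<epsilon> K by simp
      fix B' assume B': "H_nonneg n (1\<^sub>m n) B' \<and> mat_norm (B - B') < \<epsilon> / K"
      then obtain T where T: "H_nonneg_sqrt n (1\<^sub>m n) B' T" using psd_sqrt_exists by blast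
      define N where "N = mat_norm (?S - T)"
      define e where "e = mat_norm (B - B')"
      have e: "0 \<le> e" "e < \<epsilon> / K" using B' mat_norm_nonneg by (auto simp: e_def)
      have TT: "T * T = B'" and Tn: "H_nonneg n (1\<^sub>m n) T" using T by (auto simp: H_nonneg_sqrt_def)
      have bound: "N\<^sup>2 \<le> N * e / m + real n * e"
        using psd_sqrt_perturbation_bound[OF Tn m, of s] gap unfolding SS TT N_def e_def by simp
      have "N < \<epsilon>"
      proof (rule ccontr)
        assume "\<not> N < \<epsilon>"
        then have N: "\<epsilon> \<le> N" "0 < N" using \<epsilon> by auto
        have "real n * e \<le> N * e * (real n / \<epsilon>)"
          using N \<epsilon> e mult_right_mono[of \<epsilon> N "real n * e"] by (simp add: field_simps)
        with bound have "N * N \<le> N * (e * K)"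
          by (simp add: K_def power2_eq_square algebra_simps)
        with N have "N \<le> e * K" by simp
        also have "\<dots> < \<epsilon>" using e K by (simp add: field_simps)
        finally show False using N by simp
      qed
      with T show "\<exists>A'. H_nonneg_sqrt n (1\<^sub>m n) B' A' \<and> mat_norm (?S - A') < \<epsilon>"
        unfolding N_def by blast
    qed
  qed
qed

section \<open>The criterion for pairs in canonical form\<close>

theorem theorem6p2:
  fixes n l1 l2 :: nat and H B :: "complex mat"
    and lams :: "real list" and eps ds :: "complex list"
    and singles :: "nat list" and couples :: "(nat \<times> nat) list"
  assumes "H \<in> carrier_mat n n" and "invertible_mat H" and "mat_adjoint H = H"
    and "H_nonneg n H B"
    and "\<forall>r::real. r < 0 \<longrightarrow> \<not> eigenvalue B (complex_of_real r)"
    and "\<forall>n_as. jordan_nf B n_as \<longrightarrow> (2, 0) \<notin> set n_as"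
    and "canonical_form B H lams eps"
    and "segre_pairing eps singles couples"
    and "l1 = length singles" and "l2 = length couples"
    and "length ds = l1" and "set ds \<subseteq> {1, -1}"
    and "reorder_mat (segre_order (length lams) singles couples) B = paired_B l1 l2 lams"
    and "reorder_mat (segre_order (length lams) singles couples) H = paired_H ds l2 (length lams)"
  shows "(\<exists>A. unconditionally_stable n H B A) \<longleftrightarrow> l2 = 0 \<and> (\<forall>i<l1. ds ! i = 1)"
proof -
  let ?q = "length lams"
  note H = assms(1,3)
  have pos: "\<And>l. l \<in> set lams \<Longrightarrow> 0 < l" and eps: "set eps \<subseteq> {1, -1}"
    and Bd: "B = diag_block_mat (map (\<lambda>l. jordan_block 1 (complex_of_real l)) lams
                         @ replicate (length eps) (jordan_block 1 0))"
    and Hd: "H = diag_block_mat (replicate ?q Q1 @ map (\<lambda>e. e \<cdot>\<^sub>m Q1) eps)"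
    using assms(7) by (auto simp: canonical_form_def)
  define s where "s i = (if i < ?q then sqrt (lams ! i) else 0)" for i
  define h where "h i = (if i < ?q then 1 else eps ! (i - ?q))" for i
  have "H = mat_diag (?q + length eps) h"
    unfolding Hd by (subst diag_block_mat_1) (auto simp: mat_diag_def h_def nth_append intro!: eq_matI)
  moreover from this have n: "n = ?q + length eps" using H(1) by (metis carrier_matD(1) mat_diag_dim)
  ultimately have Hh: "H = mat_diag n h" by simp
  have lams0: "0 \<le> lams ! i" if "i < ?q" for i
    using pos[of "lams ! i"] that by simp
  have Bs: "B = mat_diag n (\<lambda>i. complex_of_real (s i * s i))"
    unfolding Bd n using lams0
    by (subst diag_block_mat_1)
      (auto simp: mat_diag_def s_def nth_append jordan_block_def intro!: eq_matI
        simp flip: of_real_mult)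
  \<comment> \<open>The signs \<open>ds\<close> are recovered from the diagonal of the reordered \<open>H\<close>, and singles and couples
      together exhaust the zero blocks.\<close>
  have signs: "l2 = 0 \<and> (\<forall>i<l1. ds ! i = 1) \<longleftrightarrow> (\<forall>e \<in> set eps. e = 1)"
  proof -
    have ds: "ds ! i = eps ! (singles ! i)" if i: "i < l1" for i
    proof -
      have "paired_H ds l2 ?q = paired_H (map (\<lambda>i. eps ! i) singles) l2 ?q"
        using paired_form(2)[OF assms(7,8)] assms(10,14) by simp
      from arg_cong[OF this, of "\<lambda>M. M $$ (i, i)"] show ?thesis
        using i assms(9,11) unfolding paired_H_def
        by (subst (asm) (1 2) diag_block_mat_1) (auto simp: nth_append split: if_splits)
    qed
    show ?thesis
    proof
      assume L: "l2 = 0 \<and> (\<forall>i<l1. ds ! i = 1)"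
      then have "set singles = {..<length eps}"
        using assms(8,10) by (simp add: segre_pairing_def)
      with L ds assms(9) show "\<forall>e \<in> set eps. e = 1"
        by (metis in_set_conv_nth lessThan_iff)
    next
      assume one: "\<forall>e \<in> set eps. e = 1"
      have idx: "set (singles @ map fst couples @ map snd couples) = {..<length eps}"
        and sg: "\<forall>(i, j) \<in> set couples. eps ! i = 1 \<and> eps ! j = -1"
        using assms(8) by (auto simp: segre_pairing_def)
      have "couples = []"
      proof (rule ccontr)
        assume "couples \<noteq> []"
        then obtain i j where ij: "(i, j) \<in> set couples" by (cases couples) auto
        then have "j \<in> set (singles @ map fst couples @ map snd couples)" by force
        then have "eps ! j \<in> set eps" unfolding idx by simp
        then have "eps ! j = 1" using one by blast
        moreover have "eps ! j = -1" using sg ij by blast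
        ultimately show False by simp
      qed
      moreover have "ds ! i = 1" if "i < l1" for i
      proof -
        have "singles ! i \<in> set (singles @ map fst couples @ map snd couples)"
          using that assms(9) by simp
        then have "eps ! (singles ! i) \<in> set eps" unfolding idx by simp
        with ds[OF that] one show ?thesis by simp
      qed
      ultimately show "l2 = 0 \<and> (\<forall>i<l1. ds ! i = 1)" using assms(10) by simp
    qed
  qed
  show ?thesis
    unfolding signs
  proof
    assume "\<forall>e \<in> set eps. e = 1"
    then have "H = 1\<^sub>m n" unfolding Hh n by (intro eq_matI) (auto simp: mat_diag_def h_def)
    moreover have "0 \<le> s i" for i using lams0 by (simp add: s_def)
    ultimately show "\<exists>A. unconditionally_stable n H B A"
      using diagonal_psd_sqrt_unconditionally_stable[OF _ Bs] by blast
  next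
    assume stable: "\<exists>A. unconditionally_stable n H B A"
    show "\<forall>e \<in> set eps. e = 1"
    proof (rule ccontr)
      assume "\<not> (\<forall>e \<in> set eps. e = 1)"
      then obtain i where i: "i < length eps" "eps ! i = -1"
        using eps by (metis in_set_conv_nth insert_iff singletonD subset_iff)
      define k where "k = ?q + i"
      have k: "k < n" "h k = -1" "s k = 0" using i by (auto simp: k_def n h_def s_def)
      let ?v = "unit_vec n k :: complex vec"
      have "conjugate ?v = ?v" by (intro eq_vecI) (auto simp: unit_vec_def)
      then have "ip_H H ?v ?v = -1"
        using k H(1) by (simp add: ip_H_def mat_mult_unit_vec) (simp add: Hh mat_diag_def)
      moreover have "B *\<^sub>v ?v = 0\<^sub>v n"
        unfolding mat_mult_unit_vec[of B n n k] using k assms(4)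
        by (intro eq_vecI) (auto simp: Bs mat_diag_def mat_mult_unit_vec)
      ultimately show False
        using stable not_unconditionally_stable_if_negative_kernel_vector[OF H assms(4), of ?v]
        by (auto simp: less_complex_def)
    qed
  qed
qed

end
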